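(* If $n,r$ are integers with $5\le r<n$, then $$d_{TV}(n,r)\ll\frac1r\sum_{m=0}^{n-r-1}\nu(m,r)\,\nu(n-m,r)+\frac1r\sum_{m=n-r}^\infty\nu(m,r)+\nu(n,r).$$
   Context: $S_m$ is the symmetric group on $m$ symbols and $k_j(\sigma)$ is the number of cycles of length $j$ in $\sigma\in S_m$. For integers $m\ge0$, $r\ge1$, $$\nu(m,r)=\frac1{m!}\left|\{\sigma\in S_m:\ k_j(\sigma)=0\text{ for all }j\text{ with } r+1\le j\le m\}\right|,$$ so that $\nu(m,r)=1$ for $0\le m\le r$. With $\bar k_r(\sigma)=(k_1(\sigma),\dots,k_r(\sigma))$ and $\bar Z_r=(Z_1,\dots,Z_r)$, where $Z_j$ are independent Poisson random variables with $\mathbb EZ_j=1/j$, $$d_{TV}(n,r)=\sup_{V\subset\mathbb N_0^r}\left|\frac{\#\{\sigma\in S_n:\ \bar k_r(\sigma)\in V\}}{n!}-\Pr(\bar Z_r\in V)\right|.$$ $A\ll B$ means $A\le CB$ with an absolute constant $C>0$, uniformly over all $n,r$ in the stated range. *)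

theory Defs
  imports "HOL-Probability.Probability" "HOL-Combinatorics.Orbits"
begin

text \<open>
  The symmetric group on \<open>m\<close> symbols is represented by the functions \<open>\<sigma>\<close> with
  \<open>\<sigma> permutes {1..m}\<close>; a cycle of such a permutation is identified with the orbit it acts on
  (fixed points are the cycles of length 1).
\<close>

definition cycle_count :: "nat \<Rightarrow> (nat \<Rightarrow> nat) \<Rightarrow> nat \<Rightarrow> nat" where
  "cycle_count m \<sigma> j = card {c \<in> orbit \<sigma> ` {1..m}. card c = j}"

definition nu :: "nat \<Rightarrow> nat \<Rightarrow> real" where
  "nu m r = real (card {\<sigma>. \<sigma> permutes {1..m} \<and>
                         (\<forall>j. r + 1 \<le> j \<and> j \<le> m \<longrightarrow> cycle_count m \<sigma> j = 0)}) / fact m"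

text \<open>
  A vector \<open>(v\<^sub>1, \<dots>, v\<^sub>r)\<close> of natural numbers is represented by a function \<open>nat \<Rightarrow> nat\<close>
  that vanishes outside \<open>{1..r}\<close>, in accordance with the default value 0 in the product
  distribution \<open>poisson_vector\<close> below.
\<close>

definition nat_vectors :: "nat \<Rightarrow> (nat \<Rightarrow> nat) set" where
  "nat_vectors r = PiE_dflt {1..r} 0 (\<lambda>_. UNIV)"

definition cycle_vector :: "nat \<Rightarrow> nat \<Rightarrow> (nat \<Rightarrow> nat) \<Rightarrow> (nat \<Rightarrow> nat)" where
  "cycle_vector n r \<sigma> = (\<lambda>j. if j \<in> {1..r} then cycle_count n \<sigma> j else 0)"

text \<open>The joint law of independent Poisson variables \<open>Z\<^sub>1, \<dots>, Z\<^sub>r\<close> with means \<open>1/j\<close>.\<close>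

definition poisson_vector :: "nat \<Rightarrow> (nat \<Rightarrow> nat) pmf" where
  "poisson_vector r = Pi_pmf {1..r} 0 (\<lambda>j. poisson_pmf (1 / real j))"

definition d_TV :: "nat \<Rightarrow> nat \<Rightarrow> real" where
  "d_TV n r = (SUP V \<in> Pow (nat_vectors r).
     \<bar>real (card {\<sigma>. \<sigma> permutes {1..n} \<and> cycle_vector n r \<sigma> \<in> V}) / fact n
        - measure_pmf.prob (poisson_vector r) V\<bar>)"

lemma nu_eq_1: "m \<le> r \<Longrightarrow> nu m r = 1"
proof -
  assume "m \<le> r"
  then have "{\<sigma>. \<sigma> permutes {1..m} \<and> (\<forall>j. r + 1 \<le> j \<and> j \<le> m \<longrightarrow> cycle_count m \<sigma> j = 0)}
      = {\<sigma>. \<sigma> permutes {1..m}}"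
    by auto
  then show ?thesis
    by (simp add: nu_def card_permutations)
qed

end

theory Submission
  imports Defs
begin

text \<open>
  Write \<open>v\<close> for a vector of short cycle counts and \<open>m = \<Sum> j * v j\<close> for its weight. With
  Cauchy's weight \<open>w v = \<Prod> 1/(j^v j * (v j)!)\<close>, a random permutation of \<open>n\<close> symbols has short cycle
  counts \<open>v\<close> with probability \<open>w v * rough (n - m)\<close> if \<open>m \<le> n\<close> (and 0 otherwise), where \<open>rough k\<close> is
  the proportion of permutations of \<open>k\<close> symbols without cycles of length at most \<open>r\<close>
  (\<open>card_permutes_with_cycle_counts\<close>). The Poisson vector takes the value \<open>v\<close> with probability
  \<open>w v * E\<close>, where \<open>E = exp (- harm r)\<close>. Since the weights \<open>w v\<close> of the vectors of weight \<open>m\<close> sum to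
  \<open>nu m\<close>, the total variation distance is at most
  \<open>\<Sum> nu m * \<bar>rough (n - m) - E\<bar>\<close> over \<open>m \<le> n\<close>, plus \<open>E * \<Sum> nu m\<close> over \<open>m > n\<close> (\<open>deviation_le\<close>).

  Here \<open>E \<le> 1/r\<close>, and \<open>rough (n - m)\<close> is 1 for \<open>m = n\<close> and 0 for \<open>n - r \<le> m < n\<close>, so
  these \<open>m\<close>, with the Poisson mass beyond \<open>n\<close>, account for the last two terms of the theorem. The first term needs \<open>\<bar>rough k - E\<bar> \<le> (12/r) * nu k\<close> for \<open>k > r\<close>
  (\<open>rough_close_limit\<close>). Conditioning on the length of the cycle through a marked point gives
  \<open>k * nu k = nu (k - r) + \<dots> + nu (k - 1)\<close>, and for the increments \<open>b\<close> of \<open>rough\<close> the same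
  recurrence with the opposite sign. So \<open>\<bar>b k\<bar>\<close> is bounded by a multiple of \<open>nu k\<close> as soon as it is on
  one window of length \<open>r\<close>, where it is of order \<open>1/r\<^sup>2\<close> while \<open>nu\<close> is bounded below
  (\<open>abs_rough_increment_le\<close>). The tail of \<open>nu\<close> beyond \<open>k\<close> is at most \<open>2 * r * nu k\<close>
  (\<open>sum_nu_tail_le\<close>), so \<open>rough k\<close> differs from its limit by at most a multiple of \<open>nu k / r\<close>.
  The limit is \<open>E\<close> because the convolution of \<open>nu\<close> and \<open>rough\<close> is constantly 1, as the
  joint law has total mass 1, while \<open>nu\<close> sums to \<open>1/E\<close> (\<open>rough_tendsto\<close>).
\<close>

section \<open>Splitting off the cycle through a marked point\<close>

text \<open>
  Defined over an arbitrary carrier because the inductions below delete a whole cycle, and what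
  remains of an initial segment is in general not an initial segment.
\<close>

definition num_cycles :: "('a \<Rightarrow> 'a) \<Rightarrow> 'a set \<Rightarrow> nat \<Rightarrow> nat" where
  "num_cycles \<sigma> A j = card {c \<in> orbit \<sigma> ` A. card c = j}"

lemma cycle_count_eq_num_cycles: "cycle_count m \<sigma> j = num_cycles \<sigma> {1..m} j"
  by (simp add: cycle_count_def num_cycles_def)

lemma orbit_comp_disjoint:
  assumes c: "c permutes C" "orbit c a = C" and t: "\<tau> permutes A - C" and C: "finite C"
  shows "x \<in> C \<Longrightarrow> orbit (c \<circ> \<tau>) x = C" "x \<in> A - C \<Longrightarrow> orbit (c \<circ> \<tau>) x = orbit \<tau> x"
proof -
  assume x: "x \<in> C"
  have "orbit c x = orbit (c \<circ> \<tau>) x"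
    by (rule orbit_cong0[OF x]) (use c t in \<open>auto simp: permutes_in_image permutes_not_in\<close>)
  moreover have "orbit c x = C"
    using cyclic_on_orbit[OF c(1) C] c(2) x orbit_cyclic_eq3 by metis
  ultimately show "orbit (c \<circ> \<tau>) x = C" by simp
next
  assume x: "x \<in> A - C"
  have "\<tau> y \<in> A - C" if "y \<in> A - C" for y
    using that t by (simp only: permutes_in_image)
  then have "orbit \<tau> x = orbit (c \<circ> \<tau>) x"
    by (intro orbit_cong0[OF x]) (use c in \<open>auto simp: permutes_not_in\<close>)
  then show "orbit (c \<circ> \<tau>) x = orbit \<tau> x" by simp
qed

text \<open>
  Since \<open>c\<close> and \<open>\<tau>\<close> move disjoint sets, the orbits of \<open>c \<circ> \<tau>\<close> are those of \<open>\<tau>\<close> and the one orbit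
  \<open>C\<close> of \<open>c\<close>.
\<close>

lemma num_cycles_comp_cycle:
  assumes c: "c permutes C" "orbit c a = C" and t: "\<tau> permutes A - C"
    and "finite A" "C \<subseteq> A" "a \<in> C"
  shows "num_cycles (c \<circ> \<tau>) A = (\<lambda>j. num_cycles \<tau> (A - C) j + (if j = card C then 1 else 0))"
proof
  fix j
  have fin: "finite C" using assms finite_subset by blast
  have "orbit (c \<circ> \<tau>) ` A = orbit (c \<circ> \<tau>) ` C \<union> orbit (c \<circ> \<tau>) ` (A - C)"
    using \<open>C \<subseteq> A\<close> by blast
  also have "orbit (c \<circ> \<tau>) ` C = {C}"
    using orbit_comp_disjoint(1)[OF c t fin] \<open>a \<in> C\<close> by auto
  also have "orbit (c \<circ> \<tau>) ` (A - C) = orbit \<tau> ` (A - C)"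
    using orbit_comp_disjoint(2)[OF c t fin] by (intro image_cong) auto
  finally have "orbit (c \<circ> \<tau>) ` A = insert C (orbit \<tau> ` (A - C))"
    by (simp only: insert_is_Un[symmetric])
  moreover have "C \<notin> orbit \<tau> ` (A - C)"
    using permutes_orbit_subset[OF t] \<open>a \<in> C\<close> by blast
  ultimately have "{d \<in> orbit (c \<circ> \<tau>) ` A. card d = j} =
      (if j = card C then insert C {d \<in> orbit \<tau> ` (A - C). card d = j}
       else {d \<in> orbit \<tau> ` (A - C). card d = j})" "C \<notin> {d \<in> orbit \<tau> ` (A - C). card d = j}"
    by auto
  moreover have "finite {d \<in> orbit \<tau> ` (A - C). card d = j}"
    using \<open>finite A\<close> by simp
  ultimately show "num_cycles (c \<circ> \<tau>) A j = num_cycles \<tau> (A - C) j + (if j = card C then 1 else 0)"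
    unfolding num_cycles_def by (cases "j = card C") (simp_all only: card_insert_disjoint if_True if_False, simp_all)
qed

text \<open>
  A permutation is determined by its restrictions to the cycle through a marked point \<open>a\<close> and to the
  complement of that cycle, and these can be chosen independently. The predicate \<open>Q\<close> on cycle counts
  is carried along, shifted by the cycle that has been split off.
\<close>

lemma bij_betw_split_cycle:
  assumes "finite A" "C \<subseteq> A" "a \<in> C"
  shows "bij_betw (\<lambda>(c, \<tau>). c \<circ> \<tau>)
     ({c. c permutes C \<and> orbit c a = C} \<times>
      {\<tau>. \<tau> permutes A - C \<and> Q (\<lambda>j. num_cycles \<tau> (A - C) j + (if j = card C then 1 else 0))})
     {\<sigma>. \<sigma> permutes A \<and> orbit \<sigma> a = C \<and> Q (num_cycles \<sigma> A)}"
proof (rule bij_betw_byWitness[where f' = "\<lambda>\<sigma>. (perm_restrict \<sigma> C, perm_restrict \<sigma> (A - C))"],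
    goal_cases)
  case 1
  have "perm_restrict (c \<circ> \<tau>) C = c \<and> perm_restrict (c \<circ> \<tau>) (A - C) = \<tau>"
    if "c permutes C" "\<tau> permutes A - C" for c \<tau>
  proof -
    have "\<tau> y \<in> A - C" if "y \<in> A - C" for y
      using that \<open>\<tau> permutes A - C\<close> by (simp only: permutes_in_image)
    then show ?thesis
      using that by (auto simp: fun_eq_iff perm_restrict_def permutes_not_in)
  qed
  then show ?case by (auto simp del: Diff_iff)
next
  have fin: "finite C" using assms finite_subset by blast
  have *: "perm_restrict \<sigma> C permutes C" "orbit (perm_restrict \<sigma> C) a = C"
    "perm_restrict \<sigma> (A - C) permutes A - C"
    "perm_restrict \<sigma> C \<circ> perm_restrict \<sigma> (A - C) = \<sigma>"
    if s: "\<sigma> permutes A" "orbit \<sigma> a = C" for \<sigma>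
  proof -
    have cyc: "cyclic_on \<sigma> C" using cyclic_on_orbit[OF s(1) \<open>finite A\<close>] s(2) by metis
    show 1: "perm_restrict \<sigma> (A - C) permutes A - C"
      by (rule perm_restrict_diff_cyclic[OF s(1) cyc])
    have in_C: "\<sigma> y \<in> C" if "y \<in> C" for y using cyclic_on_inI[OF cyc that] .
    have "inj_on (perm_restrict \<sigma> C) C"
      using permutes_inj[OF s(1)] by (auto simp: inj_on_def perm_restrict_def)
    moreover have "perm_restrict \<sigma> C ` C \<subseteq> C" using in_C by (auto simp: perm_restrict_def)
    ultimately have "bij_betw (perm_restrict \<sigma> C) C C"
      using fin by (simp add: bij_betw_def endo_inj_surj)
    then show 2: "perm_restrict \<sigma> C permutes C"
      by (rule bij_imp_permutes) (simp add: perm_restrict_def)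
    have "orbit (perm_restrict \<sigma> C) a = orbit \<sigma> a"
      by (rule orbit_cong0[OF \<open>a \<in> C\<close>]) (use in_C in \<open>auto simp: perm_restrict_def\<close>)
    then show "orbit (perm_restrict \<sigma> C) a = C" using s by simp
    have "perm_restrict \<sigma> C \<circ> perm_restrict \<sigma> (A - C) = perm_restrict \<sigma> A"
      using perm_restrict_union[OF 2 1] \<open>C \<subseteq> A\<close> by (simp add: Un_absorb1)
    then show "perm_restrict \<sigma> C \<circ> perm_restrict \<sigma> (A - C) = \<sigma>" using s by simp
  qed
  {
    case 2
    show ?case using * by auto
  next
    case 3
    show ?case
    proof (rule image_subsetI, elim SigmaE, simp only: prod.case mem_Collect_eq, elim conjE)
      fix c \<tau>
      assume c: "c permutes C" "orbit c a = C" and t: "\<tau> permutes A - C"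
        and Q: "Q (\<lambda>j. num_cycles \<tau> (A - C) j + (if j = card C then 1 else 0))"
      have "c permutes A" "\<tau> permutes A"
        using permutes_subset[OF c(1) \<open>C \<subseteq> A\<close>] permutes_subset[OF t] by simp_all
      then have "c \<circ> \<tau> permutes A" by (rule permutes_compose[rotated])
      moreover have "orbit (c \<circ> \<tau>) a = C"
        by (rule orbit_comp_disjoint(1)[OF c(1) c(2) t fin \<open>a \<in> C\<close>])
      ultimately show "c \<circ> \<tau> permutes A \<and> orbit (c \<circ> \<tau>) a = C \<and> Q (num_cycles (c \<circ> \<tau>) A)"
        using Q num_cycles_comp_cycle[OF c(1) c(2) t assms] by simp
    qed
  next
    case 4
    show ?case
    proof (rule image_subsetI)
      fix \<sigma> assume "\<sigma> \<in> {\<sigma>. \<sigma> permutes A \<and> orbit \<sigma> a = C \<and> Q (num_cycles \<sigma> A)}"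
      then have s: "\<sigma> permutes A" "orbit \<sigma> a = C" and Q: "Q (num_cycles \<sigma> A)" by auto
      note r = *[OF s]
      have "Q (\<lambda>j. num_cycles (perm_restrict \<sigma> (A - C)) (A - C) j + (if j = card C then 1 else 0))"
        using Q num_cycles_comp_cycle[OF r(1-3) assms] unfolding r(4) by simp
      then show "(perm_restrict \<sigma> C, perm_restrict \<sigma> (A - C)) \<in>
        {c. c permutes C \<and> orbit c a = C} \<times> {\<tau>. \<tau> permutes A - C \<and>
           Q (\<lambda>j. num_cycles \<tau> (A - C) j + (if j = card C then 1 else 0))}"
        using r by simp
    qed
  }
qed

lemma sum_subsets_containing:
  fixes f :: "nat \<Rightarrow> 'b::comm_semiring_1"
  assumes "finite A" "a \<in> A"
  shows "(\<Sum>C | C \<subseteq> A \<and> a \<in> C. f (card C)) =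
         (\<Sum>j=1..card A. of_nat ((card A - 1) choose (j - 1)) * f j)"
proof -
  let ?B = "A - {a}"
  have "(\<Sum>C | C \<subseteq> A \<and> a \<in> C. f (card C)) = (\<Sum>D \<in> Pow ?B. f (Suc (card D)))"
  proof (rule sum.reindex_bij_witness[where i = "insert a" and j = "\<lambda>C. C - {a}"])
    fix C assume "C \<in> {C. C \<subseteq> A \<and> a \<in> C}"
    then show "f (Suc (card (C - {a}))) = f (card C)"
      using card_Suc_Diff1[of C a] \<open>finite A\<close> finite_subset[of C A] by simp
  qed (use assms in auto)
  also have "\<dots> = (\<Sum>i\<le>card ?B. \<Sum>D \<in> {D. D \<subseteq> ?B \<and> card D = i}. f (Suc (card D)))"
  proof -
    have "card ` Pow ?B \<subseteq> {..card ?B}"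
      using assms by (auto intro!: card_mono simp del: card_Diff_insert)
    then show ?thesis
      using assms by (subst sum.group[symmetric, where g = card and T = "{..card ?B}"]) simp_all
  qed
  also have "\<dots> = (\<Sum>i\<le>card ?B. of_nat (card ?B choose i) * f (Suc i))"
    using assms by (intro sum.cong refl) (simp add: n_subsets)
  also have "\<dots> = (\<Sum>j=1..card A. of_nat ((card A - 1) choose (j - 1)) * f j)"
    by (rule sum.reindex_bij_witness[where i = "\<lambda>j. j - 1" and j = Suc])
      (use assms card_gt_0_iff[of A] in auto)
  finally show ?thesis .
qed

lemma card_permutes_split:
  assumes "finite A" "a \<in> A"
  shows "card {\<sigma>. \<sigma> permutes A \<and> Q (num_cycles \<sigma> A)} =
    (\<Sum>C | C \<subseteq> A \<and> a \<in> C. card {c. c permutes C \<and> orbit c a = C} *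
       card {\<tau>. \<tau> permutes A - C \<and> Q (\<lambda>j. num_cycles \<tau> (A - C) j + (if j = card C then 1 else 0))})"
proof -
  let ?S = "\<lambda>C. {\<sigma>. \<sigma> permutes A \<and> orbit \<sigma> a = C \<and> Q (num_cycles \<sigma> A)}"
  have fin: "finite {\<sigma>. \<sigma> permutes A \<and> P \<sigma>}" for P
    using finite_permutations[OF \<open>finite A\<close>] by (rule rev_finite_subset) auto
  have "a \<in> orbit \<sigma> a" if "\<sigma> permutes A" for \<sigma>
    using that \<open>finite A\<close> by (intro permutation_self_in_orbit) (auto simp: permutation_permutes)
  then have "{\<sigma>. \<sigma> permutes A \<and> Q (num_cycles \<sigma> A)} = (\<Union>C\<in>{C. C \<subseteq> A \<and> a \<in> C}. ?S C)"
    using permutes_orbit_subset[OF _ \<open>a \<in> A\<close>] by auto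
  also have "card \<dots> = (\<Sum>C | C \<subseteq> A \<and> a \<in> C. card (?S C))"
    using assms fin by (intro card_UN_disjoint) auto
  also have "\<dots> = (\<Sum>C | C \<subseteq> A \<and> a \<in> C. card {c. c permutes C \<and> orbit c a = C} *
       card {\<tau>. \<tau> permutes A - C \<and> Q (\<lambda>j. num_cycles \<tau> (A - C) j + (if j = card C then 1 else 0))})"
    using bij_betw_same_card[OF bij_betw_split_cycle[OF \<open>finite A\<close>]]
    by (intro sum.cong refl) (simp add: card_cartesian_product)
  finally show ?thesis .
qed

lemma choose_mult_fact_fact:
  assumes "1 \<le> j" "j \<le> n"
  shows "((n - 1) choose (j - 1)) * (fact (j - 1) * fact (n - j)) = (fact (n - 1) :: nat)"
  using binomial_fact_lemma[of "j - 1" "n - 1"] assms by (simp add: mult_ac)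

text \<open>
  The cycles are not enumerated. Splitting all permutations of \<open>C\<close> by the cycle \<open>B\<close> through \<open>a\<close> shows
  that the numbers of cyclic permutations satisfy \<open>n! = \<Sum> f B * (n - |B|)!\<close>. The numbers
  \<open>(|B| - 1)!\<close> satisfy the same equation, so if both agree on all proper subsets they agree on \<open>C\<close>.
\<close>

lemma card_cyclic_permutations:
  assumes "finite C" "a \<in> C"
  shows "card {c. c permutes C \<and> orbit c a = C} = fact (card C - 1)"
  using assms
proof (induction "card C" arbitrary: C rule: less_induct)
  case less
  let ?n = "card C" and ?f = "\<lambda>B. card {c. c permutes B \<and> orbit c a = B}"
  let ?S = "{B. B \<subseteq> C \<and> a \<in> B}"
  have S: "finite ?S" "C \<in> ?S" using less.prems by auto
  have n: "?n > 0" using less.prems card_gt_0_iff by blast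
  have "(\<Sum>B\<in>?S. fact (card B - 1) * fact (?n - card B) :: nat)
      = (\<Sum>j=1..?n. ((?n - 1) choose (j - 1)) * (fact (j - 1) * fact (?n - j)))"
    using sum_subsets_containing[OF less.prems, of "\<lambda>j. fact (j - 1) * fact (?n - j) :: nat"]
    by simp
  also have "\<dots> = (\<Sum>j=1..?n. fact (?n - 1))"
    by (intro sum.cong refl choose_mult_fact_fact) auto
  also have "\<dots> = fact ?n" using n by (simp add: fact_reduce)
  also have "\<dots> = (\<Sum>B\<in>?S. ?f B * fact (?n - card B))"
  proof -
    have "card {\<tau>. \<tau> permutes C - B} = fact (?n - card B)" if "B \<in> ?S" for B
      using that less.prems finite_subset[of B C]
      by (simp add: card_permutations card_Diff_subset)
    then show ?thesis
      using card_permutes_split[OF less.prems, of "\<lambda>_. True"] less.prems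
      by (simp add: card_permutations)
  qed
  also have "\<dots> = ?f C * fact (?n - ?n) + (\<Sum>B\<in>?S - {C}. ?f B * fact (?n - card B))"
    by (rule sum.remove[OF S])
  also have "(\<Sum>B\<in>?S - {C}. ?f B * fact (?n - card B)) =
      (\<Sum>B\<in>?S - {C}. fact (card B - 1) * fact (?n - card B))"
  proof (intro sum.cong refl arg_cong2[of _ _ _ _ "(*)"])
    fix B assume B: "B \<in> ?S - {C}"
    then have "B \<subset> C" by blast
    then have "card B < card C" using less.prems psubset_card_mono by blast
    then show "?f B = fact (card B - 1)"
      using B less.hyps[of B] less.prems finite_subset[of B C] by blast
  qed
  also have "(\<Sum>B\<in>?S. fact (card B - 1) * fact (?n - card B) :: nat) =
      fact (?n - 1) * fact (?n - ?n) + (\<Sum>B\<in>?S - {C}. fact (card B - 1) * fact (?n - card B))"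
    by (rule sum.remove[OF S])
  finally show ?case by simp
qed

text \<open>
  The length of the cycle through a marked point is uniformly distributed on \<open>{1..n}\<close>: the number of
  sets \<open>C\<close> of size \<open>j\<close>, of cyclic permutations of \<open>C\<close> and of permutations of the rest multiply to
  \<open>(n - 1)!\<close> for each \<open>j\<close>. Every recurrence for cycle statistics then follows by conditioning on
  that length; \<open>G j\<close> is the conditional probability of \<open>Q\<close> given length \<open>j\<close>.
\<close>

lemma card_permutes_rec:
  fixes G :: "nat \<Rightarrow> real"
  assumes "finite A" "A \<noteq> {}"
    and G: "\<And>C. C \<subseteq> A \<Longrightarrow> C \<noteq> {} \<Longrightarrow>
      real (card {\<tau>. \<tau> permutes A - C \<and> Q (\<lambda>j. num_cycles \<tau> (A - C) j + (if j = card C then 1 else 0))})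
        = fact (card A - card C) * G (card C)"
  shows "real (card {\<sigma>. \<sigma> permutes A \<and> Q (num_cycles \<sigma> A)}) =
    fact (card A - 1) * (\<Sum>j=1..card A. G j)"
proof -
  let ?n = "card A"
  obtain a where a: "a \<in> A" using assms by blast
  have "real (card {\<sigma>. \<sigma> permutes A \<and> Q (num_cycles \<sigma> A)}) =
     (\<Sum>C | C \<subseteq> A \<and> a \<in> C. real (card {c. c permutes C \<and> orbit c a = C}) *
       real (card {\<tau>. \<tau> permutes A - C \<and> Q (\<lambda>j. num_cycles \<tau> (A - C) j + (if j = card C then 1 else 0))}))"
    by (simp add: card_permutes_split[OF \<open>finite A\<close> a])
  also have "\<dots> = (\<Sum>C | C \<subseteq> A \<and> a \<in> C. fact (card C - 1) * (fact (?n - card C) * G (card C)))"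
    using \<open>finite A\<close> card_cyclic_permutations[where 'a = 'a]
    by (intro sum.cong refl arg_cong2[of _ _ _ _ "(*)"])
      (auto simp: finite_subset intro!: G)
  also have "\<dots> = (\<Sum>j=1..?n. real ((?n - 1) choose (j - 1)) * (fact (j - 1) * (fact (?n - j) * G j)))"
    by (rule sum_subsets_containing[OF \<open>finite A\<close> a])
  also have "\<dots> = (\<Sum>j=1..?n. fact (?n - 1) * G j)"
  proof (intro sum.cong refl)
    fix j assume j: "j \<in> {1..?n}"
    have "real ((?n - 1) choose (j - 1)) * (fact (j - 1) * fact (?n - j)) = fact (?n - 1)"
      using arg_cong[OF choose_mult_fact_fact[of j ?n], of real] j by simp
    then show "real ((?n - 1) choose (j - 1)) * (fact (j - 1) * (fact (?n - j) * G j))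
      = fact (?n - 1) * G j"
      by (simp add: mult.assoc[symmetric])
  qed
  finally show ?thesis by (simp add: sum_distrib_left)
qed

section \<open>The joint law of the short cycle counts\<close>

definition weight :: "nat \<Rightarrow> (nat \<Rightarrow> nat) \<Rightarrow> nat" where
  "weight r v = (\<Sum>j=1..r. j * v j)"

text \<open>
  Cauchy's cycle-type weight, which is also the product of the Poisson probabilities
  with means \<open>1/j\<close> up to their common normalising factor.
\<close>

definition cauchy_weight :: "nat \<Rightarrow> (nat \<Rightarrow> nat) \<Rightarrow> real" where
  "cauchy_weight r v = (\<Prod>j=1..r. 1 / (real j ^ v j * fact (v j)))"

text \<open>
  The proportion of permutations of \<open>k\<close> symbols without cycles of length at most \<open>r\<close> (the discrete
  analogue of Buchstab's function). The recursion conditions on the cycle through a marked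
  point: a cycle of length \<open>k - i > r\<close> leaves \<open>i\<close> symbols. That this is the proportion is the case
  of the zero vector in \<open>card_permutes_with_cycle_counts\<close> below; the recursion is taken as
  definition because it is the property that is used.
\<close>

fun rough :: "nat \<Rightarrow> nat \<Rightarrow> real" where
  "rough r k = (if k = 0 then 1 else (\<Sum>i<k - r. rough r i) / real k)"

declare rough.simps [simp del]

lemma rough_0 [simp]: "rough r 0 = 1"
  by (simp add: rough.simps)

lemma rough_rec: "real k * rough r k = (\<Sum>i<k - r. rough r i)" if "k > 0"
  using that by (subst rough.simps) simp

text \<open>
  Removing one cycle of length \<open>j\<close> lowers the weight by \<open>j\<close> and multiplies Cauchy's weight by
  \<open>j * v j\<close>. Summed over \<open>j\<close> these factors give back the weight, which is why every
  recurrence below closes.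
\<close>

lemma weight_decrement:
  assumes "j \<in> {1..r}" "v j > 0"
  shows "weight r v = weight r (v(j := v j - 1)) + j"
proof -
  have split: "weight r u = j * u j + (\<Sum>i\<in>{1..r} - {j}. i * u i)" for u
    unfolding weight_def using assms(1) by (intro sum.remove) auto
  have "(\<Sum>i\<in>{1..r} - {j}. i * (v(j := v j - 1)) i) = (\<Sum>i\<in>{1..r} - {j}. i * v i)"
    by (intro sum.cong) auto
  moreover have "j * v j = j * (v j - 1) + j"
    using assms by (cases "v j") auto
  ultimately show ?thesis
    unfolding split by simp
qed

lemma cauchy_weight_decrement:
  assumes "j \<in> {1..r}" "v j > 0"
  shows "cauchy_weight r (v(j := v j - 1)) = real j * real (v j) * cauchy_weight r v"
proof -
  have split: "cauchy_weight r u =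
      1 / (real j ^ u j * fact (u j)) * (\<Prod>i\<in>{1..r} - {j}. 1 / (real i ^ u i * fact (u i)))" for u
    unfolding cauchy_weight_def using assms(1) by (intro prod.remove) auto
  have "(\<Prod>i\<in>{1..r} - {j}. 1 / (real i ^ (v(j := v j - 1)) i * fact ((v(j := v j - 1)) i)))
     = (\<Prod>i\<in>{1..r} - {j}. 1 / (real i ^ v i * fact (v i)))"
    by (intro prod.cong) auto
  moreover obtain k where "v j = Suc k" using assms by (cases "v j") auto
  then have "1 / (real j ^ (v j - 1) * fact (v j - 1)) =
      real j * real (v j) * (1 / (real j ^ v j * fact (v j)))"
    using assms by (simp add: fact_Suc divide_simps del: of_nat_Suc)
  ultimately show ?thesis
    unfolding split by simp
qed

lemma mult_le_weight: "j \<in> {1..r} \<Longrightarrow> j * v j \<le> weight r v"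
  unfolding weight_def by (rule member_le_sum) auto

lemma weight_eq_0_iff: "weight r v = 0 \<longleftrightarrow> (\<forall>j\<in>{1..r}. v j = 0)"
  unfolding weight_def by auto

text \<open>
  The short cycles contribute Cauchy's weight; the symbols that they leave over must carry a
  permutation with long cycles only.
\<close>

definition joint_law :: "nat \<Rightarrow> nat \<Rightarrow> (nat \<Rightarrow> nat) \<Rightarrow> real" where
  "joint_law n r v =
     (if weight r v \<le> n then cauchy_weight r v * rough r (n - weight r v) else 0)"

text \<open>
  A marked point on a short cycle contributes \<open>j * v j\<close> times the law for each length \<open>j \<le> r\<close>, hence
  \<open>weight r v\<close> times the law in total; a marked point on a long cycle contributes the remaining
  \<open>n - weight r v\<close> times the law by the recurrence of \<open>rough\<close>.
\<close>

lemma joint_law_rec: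
  assumes "n > 0"
  shows "real n * joint_law n r v =
    (\<Sum>j=1..n. if j \<le> r then (if v j > 0 then joint_law (n - j) r (v(j := v j - 1)) else 0)
               else joint_law (n - j) r v)"
proof -
  let ?m = "weight r v" and ?w = "cauchy_weight r v"
  let ?f = "\<lambda>j. if j \<le> r then (if v j > 0 then joint_law (n - j) r (v(j := v j - 1)) else 0)
               else joint_law (n - j) r v"
  have small: "?f j = real (j * v j) * joint_law n r v" if "j \<in> {1..n}" "j \<le> r" for j
  proof (cases "v j > 0")
    case True
    have "weight r v = weight r (v(j := v j - 1)) + j"
      using that True by (intro weight_decrement) auto
    then show ?thesis
      using that True cauchy_weight_decrement[of j r v]
      by (auto simp: joint_law_def algebra_simps)
  qed (use that in auto)
  have "(\<Sum>j=1..n. ?f j) = (\<Sum>j\<in>{1..n} \<inter> {..r}. ?f j) + (\<Sum>j\<in>{1..n} - {..r}. ?f j)"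
    by (subst sum.Int_Diff[of _ _ "{..r}"]) simp_all
  also have "(\<Sum>j\<in>{1..n} \<inter> {..r}. ?f j) = real (\<Sum>j\<in>{1..n} \<inter> {..r}. j * v j) * joint_law n r v"
    using small by (simp add: sum_distrib_right)
  also have "\<dots> = real (weight r v) * joint_law n r v"
  proof (cases "?m \<le> n")
    case True
    have "v j = 0" if "j \<in> {1..r} - {1..n}" for j
    proof (rule ccontr)
      assume "v j \<noteq> 0"
      then have "j \<le> j * v j" by simp
      also have "\<dots> \<le> n" using mult_le_weight[of j r v] that True by simp
      finally show False using that by auto
    qed
    then have "(\<Sum>j\<in>{1..n} \<inter> {..r}. j * v j) = ?m"
      unfolding weight_def by (intro sum.mono_neutral_left) auto
    then show ?thesis by simp
  qed (simp add: joint_law_def)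
  also have "(\<Sum>j\<in>{1..n} - {..r}. ?f j) = (\<Sum>j\<in>{r<..n}. joint_law (n - j) r v)"
    by (intro sum.cong) auto
  also have "\<dots> = (\<Sum>j\<in>{r<..n - ?m}. ?w * rough r (n - ?m - j))"
    by (rule sum.mono_neutral_cong_right) (auto simp: joint_law_def add.commute)
  also have "\<dots> = ?w * (\<Sum>i<n - ?m - r. rough r i)"
    unfolding sum_distrib_left
    by (rule sum.reindex_bij_witness[where i = "\<lambda>i. n - ?m - i" and j = "\<lambda>j. n - ?m - j"]) auto
  also have "real ?m * joint_law n r v + \<dots> = real n * joint_law n r v"
  proof (cases "?m < n")
    case True
    then show ?thesis
      using arg_cong[OF rough_rec[of "n - ?m" r], of "\<lambda>x. ?w * x"]
      by (simp add: joint_law_def of_nat_diff algebra_simps)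
  next
    case False
    then show ?thesis by (cases "?m = n") (auto simp: joint_law_def)
  qed
  finally show ?thesis by simp
qed

lemma card_permutes_with_cycle_counts:
  fixes A :: "'a set"
  assumes "finite A"
  shows "real (card {\<sigma>. \<sigma> permutes A \<and> (\<forall>j\<in>{1..r}. num_cycles \<sigma> A j = v j)}) =
    fact (card A) * joint_law (card A) r v"
  using assms
proof (induction "card A" arbitrary: A v rule: less_induct)
  case less
  show ?case
  proof (cases "A = {}")
    case True
    have "(\<forall>j\<in>{1..r}. 0 = v j) \<longleftrightarrow> weight r v = 0" by (auto simp: weight_eq_0_iff)
    moreover have "cauchy_weight r v = 1" if "weight r v = 0"
      using that by (simp add: weight_eq_0_iff cauchy_weight_def)
    ultimately show ?thesis
      using True by (auto simp: num_cycles_def joint_law_def)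
  next
    case False
    let ?n = "card A"
    have n: "?n > 0" using False less.prems by (simp add: card_gt_0_iff)
    define Q where "Q k \<longleftrightarrow> (\<forall>j\<in>{1..r}. k j = v j)" for k :: "nat \<Rightarrow> nat"
    define G where "G j = (if j \<le> r then (if v j > 0 then joint_law (?n - j) r (v(j := v j - 1)) else 0)
               else joint_law (?n - j) r v)" for j
    have "real (card {\<sigma>. \<sigma> permutes A \<and> Q (num_cycles \<sigma> A)}) =
        fact (?n - 1) * (\<Sum>j=1..?n. G j)"
    proof (rule card_permutes_rec[OF less.prems False])
      fix C assume C: "C \<subseteq> A" "C \<noteq> {}"
      let ?c = "card C"
      have fin: "finite C" using C less.prems finite_subset by blast
      have c: "?c > 0" using C fin by (simp add: card_gt_0_iff)
      have cA: "card (A - C) = ?n - ?c" using C fin by (simp add: card_Diff_subset)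
      have IH: "real (card {\<tau>. \<tau> permutes A - C \<and> (\<forall>j\<in>{1..r}. num_cycles \<tau> (A - C) j = u j)}) =
        fact (?n - ?c) * joint_law (?n - ?c) r u" for u
        using less.hyps[of "A - C" u] c n less.prems unfolding cA by simp
      have eq: "Q (\<lambda>j. k j + (if j = ?c then 1 else 0)) \<longleftrightarrow>
         (if ?c \<le> r then v ?c > 0 \<and> (\<forall>j\<in>{1..r}. k j = (v(?c := v ?c - 1)) j)
          else (\<forall>j\<in>{1..r}. k j = v j))" for k
      proof (cases "?c \<le> r")
        case True
        define R where "R = {1..r} - {?c}"
        have R: "{1..r} = insert ?c R" "?c \<notin> R" using True c by (auto simp: R_def)
        show ?thesis
          using True R(2) unfolding Q_def fun_upd_apply R(1) by auto
      qed (auto simp: Q_def)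
      show "real (card {\<tau>. \<tau> permutes A - C \<and> Q (\<lambda>j. num_cycles \<tau> (A - C) j + (if j = ?c then 1 else 0))})
          = fact (?n - ?c) * G ?c"
        unfolding eq G_def
        by (cases "?c \<le> r"; cases "v ?c > 0") (simp_all add: IH del: fun_upd_apply One_nat_def)
    qed
    also have "(\<Sum>j=1..?n. G j) = real ?n * joint_law ?n r v"
      unfolding G_def by (rule joint_law_rec[OF n, symmetric])
    also have "fact (?n - 1) * (real ?n * joint_law ?n r v) = fact ?n * joint_law ?n r v"
      using n by (simp add: fact_reduce[of ?n])
    finally show ?thesis unfolding Q_def .
  qed
qed

section \<open>Permutations without long cycles and the Poisson vector\<close>

definition vectors_of_weight :: "nat \<Rightarrow> nat \<Rightarrow> (nat \<Rightarrow> nat) set" where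
  "vectors_of_weight r m = {v \<in> nat_vectors r. weight r v = m}"

lemma finite_nat_vectors_weight_le: "finite {v \<in> nat_vectors r. weight r v \<le> n}"
proof (rule finite_subset)
  show "{v \<in> nat_vectors r. weight r v \<le> n} \<subseteq> PiE_dflt {1..r} 0 (\<lambda>_. {..n})"
  proof (clarify)
    fix v assume v: "v \<in> nat_vectors r" "weight r v \<le> n"
    have "v j \<le> n" if "j \<in> {1..r}" for j
    proof -
      have "v j \<le> j * v j" using that by simp
      then show ?thesis using mult_le_weight[OF that, of v] v(2) by linarith
    qed
    then show "v \<in> PiE_dflt {1..r} 0 (\<lambda>_. {..n})"
      using v(1) by (auto simp: nat_vectors_def PiE_dflt_def)
  qed
  show "finite (PiE_dflt {1..r} 0 (\<lambda>_. {..n}) :: (nat \<Rightarrow> nat) set)"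
    by (intro finite_PiE_dflt) auto
qed

lemma finite_vectors_of_weight: "finite (vectors_of_weight r m)"
  by (rule finite_subset[OF _ finite_nat_vectors_weight_le[of r m]])
    (auto simp: vectors_of_weight_def)

lemma sum_card_orbits:
  assumes "\<sigma> permutes A" "finite A"
  shows "(\<Sum>c\<in>orbit \<sigma> ` A. card c) = card A"
proof -
  have cyc: "cyclic_on \<sigma> (orbit \<sigma> x)" for x by (rule cyclic_on_orbit[OF assms])
  have "x \<in> orbit \<sigma> x" for x
    using assms by (intro permutation_self_in_orbit) (auto simp: permutation_permutes)
  then have "\<Union>(orbit \<sigma> ` A) = A"
    using permutes_orbit_subset[OF assms(1)] by blast
  moreover have "c = d" if "c \<in> orbit \<sigma> ` A" "d \<in> orbit \<sigma> ` A" "z \<in> c" "z \<in> d" for c d z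
    using that orbit_cyclic_eq3[OF cyc] by (metis imageE)
  then have "disjoint (orbit \<sigma> ` A)"
    by (intro pairwiseI) (auto simp: disjnt_def)
  moreover have "finite c" if "c \<in> orbit \<sigma> ` A" for c
    using finite_cyclic_on[OF cyc] that by auto
  ultimately show ?thesis
    using card_Union_disjoint[of "orbit \<sigma> ` A"] by simp
qed

text \<open>
  The orbits partition the carrier, and those of length at most \<open>r\<close> cover as many points as the
  weight says.
\<close>

lemma weight_num_cycles:
  assumes "\<sigma> permutes A" "finite A"
  shows "weight r (num_cycles \<sigma> A) + (\<Sum>c | c \<in> orbit \<sigma> ` A \<and> r < card c. card c) = card A"
proof -
  let ?O = "orbit \<sigma> ` A"
  let ?S = "{c \<in> ?O. card c \<in> {1..r}}"
  have fin: "finite ?O" using assms by simp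
  have "weight r (num_cycles \<sigma> A) = (\<Sum>j=1..r. \<Sum>c\<in>{c \<in> ?S. card c = j}. card c)"
    unfolding weight_def num_cycles_def
  proof (intro sum.cong refl)
    fix j assume "j \<in> {1..r}"
    then have "{c \<in> ?S. card c = j} = {c \<in> ?O. card c = j}" by auto
    then show "j * card {c \<in> ?O. card c = j} = (\<Sum>c\<in>{c \<in> ?S. card c = j}. card c)"
      by simp
  qed
  also have "\<dots> = (\<Sum>c\<in>?S. card c)"
    using fin by (intro sum.group) auto
  also have "\<dots> + (\<Sum>c | c \<in> ?O \<and> r < card c. card c) = (\<Sum>c\<in>?S \<union> {c. c \<in> ?O \<and> r < card c}. card c)"
    using fin by (intro sum.union_disjoint[symmetric]) auto
  also have "\<dots> = (\<Sum>c\<in>?O. card c)"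
    using fin by (intro sum.mono_neutral_left) auto
  finally show ?thesis using sum_card_orbits[OF assms] by simp
qed

lemma no_long_cycles_iff_weight:
  assumes "\<sigma> permutes {1..m}"
  shows "(\<forall>j. r + 1 \<le> j \<and> j \<le> m \<longrightarrow> cycle_count m \<sigma> j = 0) \<longleftrightarrow> weight r (num_cycles \<sigma> {1..m}) = m"
proof -
  let ?O = "orbit \<sigma> ` {1..m}"
  have le: "card c \<le> m" if "c \<in> ?O" for c
    using that permutes_orbit_subset[OF assms] card_mono[of "{1..m}" c] by fastforce
  have "(\<forall>j. r + 1 \<le> j \<and> j \<le> m \<longrightarrow> cycle_count m \<sigma> j = 0) \<longleftrightarrow> (\<forall>c\<in>?O. card c \<le> r)"
  proof (intro iffI ballI allI impI)
    fix c assume *: "\<forall>j. r + 1 \<le> j \<and> j \<le> m \<longrightarrow> cycle_count m \<sigma> j = 0" and c: "c \<in> ?O"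
    have "c \<in> {d \<in> ?O. card d = card c}" using c by blast
    then have "cycle_count m \<sigma> (card c) \<noteq> 0"
      unfolding cycle_count_def by (subst card_0_eq) auto
    then show "card c \<le> r" using * le[OF c] by (cases "card c \<le> r") auto
  next
    fix j assume *: "\<forall>c\<in>?O. card c \<le> r" and j: "r + 1 \<le> j \<and> j \<le> m"
    then have "{c \<in> ?O. card c = j} = {}" by auto
    then show "cycle_count m \<sigma> j = 0" unfolding cycle_count_def by simp
  qed
  also have "\<dots> \<longleftrightarrow> (\<Sum>c | c \<in> ?O \<and> r < card c. card c) = 0"
    by auto
  also have "\<dots> \<longleftrightarrow> weight r (num_cycles \<sigma> {1..m}) = m"
  proof -
    have "weight r (num_cycles \<sigma> {1..m}) + (\<Sum>c | c \<in> ?O \<and> r < card c. card c) = m"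
      using weight_num_cycles[OF assms, of r] by simp
    then show ?thesis by linarith
  qed
  finally show ?thesis .
qed

lemma weight_cycle_vector: "weight r (cycle_vector n r \<sigma>) = weight r (num_cycles \<sigma> {1..n})"
  unfolding weight_def by (intro sum.cong) (auto simp: cycle_vector_def cycle_count_eq_num_cycles)

text \<open>
  Vectors of weight above \<open>n\<close> are not attained, so the event is a finite union of the events described
  by the joint law.
\<close>

lemma card_cycle_vector_in:
  assumes "V \<subseteq> nat_vectors r"
  shows "real (card {\<sigma>. \<sigma> permutes {1..n} \<and> cycle_vector n r \<sigma> \<in> V}) / fact n
    = (\<Sum>v | v \<in> V \<and> weight r v \<le> n. cauchy_weight r v * rough r (n - weight r v))"
proof -
  let ?V = "{v. v \<in> V \<and> weight r v \<le> n}"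
  let ?S = "\<lambda>v. {\<sigma>. \<sigma> permutes {1..n} \<and> (\<forall>j\<in>{1..r}. num_cycles \<sigma> {1..n} j = v j)}"
  let ?T = "\<lambda>v. {\<sigma>. \<sigma> permutes {1..n} \<and> cycle_vector n r \<sigma> = v}"
  have fin: "finite ?V"
    using finite_nat_vectors_weight_le[of r n] by (rule rev_finite_subset) (use assms in auto)
  have eq: "cycle_vector n r \<sigma> = v \<longleftrightarrow> (\<forall>j\<in>{1..r}. num_cycles \<sigma> {1..n} j = v j)" if "v \<in> V" for v \<sigma>
    using that assms
    by (auto simp: cycle_vector_def nat_vectors_def PiE_dflt_def fun_eq_iff cycle_count_eq_num_cycles)
  have "weight r (cycle_vector n r \<sigma>) \<le> n" if "\<sigma> permutes {1..n}" for \<sigma>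
    using weight_num_cycles[OF that, of r] by (simp add: weight_cycle_vector)
  then have partition: "{\<sigma>. \<sigma> permutes {1..n} \<and> cycle_vector n r \<sigma> \<in> V} = (\<Union>v\<in>?V. ?T v)"
    by auto
  have "real (card {\<sigma>. \<sigma> permutes {1..n} \<and> cycle_vector n r \<sigma> \<in> V}) =
      (\<Sum>v\<in>?V. real (card (?T v)))"
    unfolding partition of_nat_sum[symmetric]
  proof (intro arg_cong[of _ _ real] card_UN_disjoint ballI impI)
    show "finite (?T v)" for v
      using finite_permutations[of "{1..n}"] by (rule rev_finite_subset) auto
  qed (use fin in auto)
  also have "\<dots> = (\<Sum>v\<in>?V. real (card (?S v)))"
  proof (rule sum.cong[OF refl])
    fix v assume "v \<in> ?V"
    then have "v \<in> V" by simp
    then show "real (card (?T v)) = real (card (?S v))" by (simp only: eq[OF \<open>v \<in> V\<close>])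
  qed
  also have "\<dots> = (\<Sum>v\<in>?V. fact n * (cauchy_weight r v * rough r (n - weight r v)))"
  proof (rule sum.cong[OF refl])
    fix v assume "v \<in> ?V"
    then show "real (card (?S v)) = fact n * (cauchy_weight r v * rough r (n - weight r v))"
      using card_permutes_with_cycle_counts[of "{1..n}" r v] by (simp add: joint_law_def)
  qed
  finally show ?thesis by (simp add: sum_distrib_left[symmetric])
qed

text \<open>
  A permutation of \<open>m\<close> symbols has no cycle longer than \<open>r\<close> precisely when its short cycles have total
  length \<open>m\<close>; then nothing is left over and the factor \<open>rough\<close> in the joint law is 1.
\<close>

lemma nu_eq_sum_cauchy_weight: "nu m r = (\<Sum>v\<in>vectors_of_weight r m. cauchy_weight r v)"
proof -
  have "cycle_vector m r \<sigma> \<in> nat_vectors r" for \<sigma>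
    by (auto simp: cycle_vector_def nat_vectors_def PiE_dflt_def)
  then have "{\<sigma>. \<sigma> permutes {1..m} \<and> (\<forall>j. r + 1 \<le> j \<and> j \<le> m \<longrightarrow> cycle_count m \<sigma> j = 0)}
    = {\<sigma>. \<sigma> permutes {1..m} \<and> cycle_vector m r \<sigma> \<in> vectors_of_weight r m}"
    using no_long_cycles_iff_weight[of _ m r] by (auto simp: vectors_of_weight_def weight_cycle_vector)
  then have "nu m r = (\<Sum>v | v \<in> vectors_of_weight r m \<and> weight r v \<le> m.
      cauchy_weight r v * rough r (m - weight r v))"
    using card_cycle_vector_in[of "vectors_of_weight r m" r m]
    unfolding nu_def by (simp only:) (auto simp: vectors_of_weight_def)
  also have "\<dots> = (\<Sum>v\<in>vectors_of_weight r m. cauchy_weight r v)"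
    by (intro sum.cong) (auto simp: vectors_of_weight_def)
  finally show ?thesis .
qed

text \<open>
  The discrete counterpart of the equation \<open>u * \<rho> u = \<integral> \<rho>\<close> over \<open>[u - 1, u]\<close> for
  Dickman's function. Multiplying \<open>cauchy_weight\<close> by the weight produces, for each length \<open>j\<close>, the
  factor \<open>j * v j\<close>, which turns it into the value at the vector with one cycle of length \<open>j\<close> fewer.
\<close>

lemma nu_rec: "real k * nu k r = (\<Sum>i\<in>{k - r..<k}. nu i r)"
proof -
  let ?V = "vectors_of_weight r" and ?w = "cauchy_weight r"
  have inner: "(\<Sum>v\<in>?V k. real (j * v j) * ?w v) = (if j \<le> k then nu (k - j) r else 0)"
    if j: "j \<in> {1..r}" for j
  proof (cases "j \<le> k")
    case True
    have "(\<Sum>v\<in>?V k. real (j * v j) * ?w v) = (\<Sum>v\<in>{v \<in> ?V k. v j > 0}. real (j * v j) * ?w v)"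
      by (intro sum.mono_neutral_right finite_vectors_of_weight) auto
    also have "\<dots> = (\<Sum>v\<in>?V (k - j). ?w v)"
    proof (rule sum.reindex_bij_witness[where i = "\<lambda>v. v(j := v j + 1)" and j = "\<lambda>v. v(j := v j - 1)"])
      fix v assume v: "v \<in> {v \<in> ?V k. v j > 0}"
      then show "v(j := v j - 1) \<in> ?V (k - j)"
        using weight_decrement[OF j, of v] j
        by (auto simp: vectors_of_weight_def nat_vectors_def PiE_dflt_def)
      show "?w (v(j := v j - 1)) = real (j * v j) * ?w v"
        using cauchy_weight_decrement[OF j, of v] v by simp
      show "(v(j := v j - 1))(j := (v(j := v j - 1)) j + 1) = v"
        using v by auto
    next
      fix v assume v: "v \<in> ?V (k - j)"
      then show "v(j := v j + 1) \<in> {v \<in> ?V k. v j > 0}"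
        using weight_decrement[OF j, of "v(j := v j + 1)"] j True
        by (auto simp: vectors_of_weight_def nat_vectors_def PiE_dflt_def)
    qed auto
    finally show ?thesis using True by (simp add: nu_eq_sum_cauchy_weight)
  next
    case False
    have "v j = 0" if "v \<in> ?V k" for v
    proof (rule ccontr)
      assume "v j \<noteq> 0"
      then have "j \<le> j * v j" by simp
      also have "\<dots> \<le> k"
        using mult_le_weight[OF j, of v] that by (simp add: vectors_of_weight_def)
      finally show False using False by simp
    qed
    then have "(\<Sum>v\<in>?V k. real (j * v j) * ?w v) = 0" by (intro sum.neutral) simp
    then show ?thesis using False by simp
  qed
  have "real k * nu k r = (\<Sum>v\<in>?V k. real (weight r v) * ?w v)"
    unfolding nu_eq_sum_cauchy_weight sum_distrib_left
    by (intro sum.cong) (auto simp: vectors_of_weight_def)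
  also have "\<dots> = (\<Sum>v\<in>?V k. \<Sum>j=1..r. real (j * v j) * ?w v)"
    by (simp add: weight_def sum_distrib_right)
  also have "\<dots> = (\<Sum>j=1..r. \<Sum>v\<in>?V k. real (j * v j) * ?w v)"
    by (rule sum.swap)
  also have "\<dots> = (\<Sum>j=1..r. if j \<le> k then nu (k - j) r else 0)"
    by (intro sum.cong refl inner)
  also have "\<dots> = (\<Sum>j\<in>{j \<in> {1..r}. j \<le> k}. nu (k - j) r)"
    by (simp add: sum.inter_filter[symmetric])
  also have "\<dots> = (\<Sum>i\<in>{k - r..<k}. nu i r)"
    by (rule sum.reindex_bij_witness[where i = "\<lambda>i. k - i" and j = "\<lambda>j. k - j"]) auto
  finally show ?thesis .
qed

lemma pmf_poisson_vector:
  assumes "v \<in> nat_vectors r"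
  shows "pmf (poisson_vector r) v = exp (- harm r) * cauchy_weight r v"
proof -
  have "pmf (poisson_vector r) v = (\<Prod>j=1..r. pmf (poisson_pmf (1 / real j)) (v j))"
    unfolding poisson_vector_def using assms
    by (intro pmf_Pi') (auto simp: nat_vectors_def PiE_dflt_def)
  also have "\<dots> = (\<Prod>j=1..r. exp (- inverse (real j)) * (1 / (real j ^ v j * fact (v j))))"
    by (intro prod.cong refl) (simp add: field_simps)
  also have "\<dots> = exp (- harm r) * cauchy_weight r v"
    by (simp only: prod.distrib cauchy_weight_def harm_def exp_sum[symmetric] sum_negf[symmetric])
      (simp add: exp_sum)
  finally show ?thesis .
qed

lemma set_pmf_poisson_vector: "set_pmf (poisson_vector r) \<subseteq> nat_vectors r"
  unfolding poisson_vector_def nat_vectors_def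
  by (rule order.trans[OF set_Pi_pmf_subset']) (auto simp: PiE_dflt_def)

text \<open>
  Both laws weight a vector by \<open>cauchy_weight\<close>, so \<open>nu\<close> is, up to the factor \<open>exp (harm r)\<close>, the
  distribution of the weight of the Poisson vector. This gives its sum, and it identifies the
  infinite sums of \<open>nu\<close> with Poisson probabilities.
\<close>

lemma pmf_weight_poisson_vector:
  "pmf (map_pmf (weight r) (poisson_vector r)) m = exp (- harm r) * nu m r"
proof -
  have "pmf (map_pmf (weight r) (poisson_vector r)) m =
      measure_pmf.prob (poisson_vector r) (weight r -` {m})"
    by (simp add: pmf_map)
  also have "\<dots> = measure_pmf.prob (poisson_vector r) (vectors_of_weight r m)"
    by (rule measure_prob_cong_0)
      (use set_pmf_poisson_vector[of r] in \<open>auto simp: vectors_of_weight_def set_pmf_eq\<close>)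
  also have "\<dots> = (\<Sum>v\<in>vectors_of_weight r m. exp (- harm r) * cauchy_weight r v)"
    unfolding measure_measure_pmf_finite[OF finite_vectors_of_weight]
    by (intro sum.cong refl pmf_poisson_vector) (auto simp: vectors_of_weight_def)
  finally show ?thesis by (simp add: nu_eq_sum_cauchy_weight sum_distrib_left)
qed

lemma summable_on_nu: "(\<lambda>m. nu m r) summable_on A"
  and infsum_nu: "exp (- harm r) * (\<Sum>\<^sub>\<infinity>m\<in>A. nu m r) =
    measure_pmf.prob (poisson_vector r) (weight r -` A)"
proof -
  let ?p = "map_pmf (weight r) (poisson_vector r)"
  have pmf_eq: "pmf ?p = (\<lambda>m. exp (- harm r) * nu m r)"
    by (intro ext pmf_weight_poisson_vector)
  have "pmf ?p summable_on A"
    using pmf_abs_summable[of ?p A] by (rule abs_summable_summable[OF iffD2[OF abs_summable_equivalent]])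
  then show "(\<lambda>m. nu m r) summable_on A"
    by (simp add: pmf_eq summable_on_cmult_right')
  have "measure_pmf.prob (poisson_vector r) (weight r -` A) = measure_pmf.prob ?p A"
    by simp
  also have "\<dots> = infsum (pmf ?p) A"
    by (simp add: measure_pmf_conv_infsetsum infsetsum_infsum pmf_abs_summable)
  also have "\<dots> = exp (- harm r) * (\<Sum>\<^sub>\<infinity>m\<in>A. nu m r)"
    by (simp add: pmf_eq infsum_cmult_right')
  finally show "exp (- harm r) * (\<Sum>\<^sub>\<infinity>m\<in>A. nu m r) =
    measure_pmf.prob (poisson_vector r) (weight r -` A)" ..
qed

lemma sums_nu: "(\<lambda>m. nu m r) sums exp (harm r)"
proof -
  have "exp (- harm r) * (\<Sum>\<^sub>\<infinity>m. nu m r) = 1"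
    using infsum_nu[of r UNIV] by simp
  then have "(\<Sum>\<^sub>\<infinity>m. nu m r) = exp (harm r)"
    by (simp add: exp_minus field_simps)
  then show ?thesis
    using has_sum_infsum[OF summable_on_nu[of r UNIV]] by (simp add: has_sum_imp_sums)
qed

section \<open>Comparison of the two recurrences\<close>

lemma nu_nonneg: "0 \<le> nu k r"
  by (simp add: nu_def)

text \<open>
  Subtracting two consecutive instances of \<open>nu_rec\<close>: the window of length \<open>r\<close> moves by one place, so
  only its two ends remain.
\<close>

lemma nu_step:
  assumes "1 \<le> r" "r \<le> k"
  shows "real (k + 1) * (nu k r - nu (k + 1) r) = nu (k - r) r"
proof -
  have "{k - r..<k} = insert (k - r) {k + 1 - r..<k}" "{k + 1 - r..<k + 1} = insert k {k + 1 - r..<k}"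
    using assms by auto
  then show ?thesis
    using nu_rec[of k r] nu_rec[of "k + 1" r] assms by (simp add: algebra_simps)
qed

lemma decseq_nu:
  assumes "1 \<le> r"
  shows "decseq (\<lambda>k. nu k r)"
proof (rule decseq_SucI)
  fix k
  show "nu (Suc k) r \<le> nu k r"
  proof (cases "r \<le> k")
    case True
    then have "0 \<le> real (k + 1) * (nu k r - nu (k + 1) r)"
      using nu_step[OF assms True] nu_nonneg by simp
    then show ?thesis by (simp add: zero_le_mult_iff)
  qed (simp add: nu_eq_1)
qed

lemma nu_antimono: "1 \<le> r \<Longrightarrow> i \<le> k \<Longrightarrow> nu k r \<le> nu i r"
  using decseqD[OF decseq_nu] .

text \<open>
  Averaging over the window gives \<open>nu k \<le> (r/k) * nu (k - r)\<close>. The resulting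
  geometric decay controls the tail of \<open>nu\<close> in \<open>sum_nu_tail_le\<close>.
\<close>

lemma nu_halves:
  assumes "1 \<le> r" "2 * r \<le> k"
  shows "2 * nu k r \<le> nu (k - r) r"
proof -
  have "real r * (2 * nu k r) = real (2 * r) * nu k r" by simp
  also have "\<dots> \<le> real k * nu k r"
    using assms nu_nonneg by (intro mult_right_mono of_nat_mono)
  also have "\<dots> = (\<Sum>i\<in>{k - r..<k}. nu i r)" by (rule nu_rec)
  also have "\<dots> \<le> (\<Sum>i\<in>{k - r..<k}. nu (k - r) r)"
    using nu_antimono[OF assms(1)] by (intro sum_mono) simp
  also have "\<dots> = real r * nu (k - r) r" using assms by simp
  finally show ?thesis using assms by simp
qed

lemma nu_ge_harmonic:
  assumes "1 \<le> r" "r \<le> k"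
  shows "1 - (\<Sum>j\<in>{r<..k}. 1 / real j) \<le> nu k r"
  using assms(2)
proof (induction k rule: dec_induct)
  case base
  show ?case by (simp add: nu_eq_1)
next
  case (step k)
  have "{r<..Suc k} = insert (Suc k) {r<..k}" using step by auto
  moreover have "real (k + 1) * (nu k r - nu (k + 1) r) \<le> 1"
    using nu_step[OF assms(1) step(1)] nu_antimono[OF assms(1), of 0 "k - r"] nu_eq_1[of 0 r] by simp
  then have "nu k r - nu (Suc k) r \<le> 1 / real (Suc k)"
    by (simp add: pos_le_divide_eq mult.commute)
  ultimately show ?case using step.IH by simp
qed

lemma harmonic_block_le: "1 \<le> r \<Longrightarrow> (\<Sum>j\<in>{r<..2 * r + 1}. 1 / real j) \<le> 5 / 6"
proof (induction r rule: dec_induct)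
  case base
  have "{1<..2 * 1 + 1} = {2, 3::nat}" by auto
  then show ?case by simp
next
  case (step r)
  have "{r<..2 * r + 1} = insert (r + 1) {r + 1<..2 * r + 1}"
    "{Suc r<..2 * Suc r + 1} = insert (2 * r + 2) (insert (2 * r + 3) {r + 1<..2 * r + 1})"
    using step by auto
  then have "(\<Sum>j\<in>{Suc r<..2 * Suc r + 1}. 1 / real j) =
      (\<Sum>j\<in>{r<..2 * r + 1}. 1 / real j) + (1 / real (2 * r + 2) + 1 / real (2 * r + 3) - 1 / real (r + 1))"
    by simp
  moreover have "1 / real (2 * r + 2) + 1 / real (2 * r + 3) - 1 / real (r + 1) \<le> 0"
  proof -
    have "1 / real (2 * r + 3) \<le> 1 / real (2 * r + 2)" by (intro divide_left_mono) auto
    moreover have "1 / real (r + 1) = 2 * (1 / real (2 * r + 2))" by (simp add: field_simps)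
    ultimately show ?thesis by linarith
  qed
  ultimately show ?case using step.IH by linarith
qed

text \<open>
  The starting window of the comparison in \<open>abs_rough_increment_le\<close> needs a lower bound for \<open>nu\<close>
  uniform in \<open>r\<close> up to \<open>2 * r + 1\<close>. By \<open>nu_step\<close> the passage to \<open>j\<close> loses at most \<open>1/j\<close>, and the
  total loss over \<open>r < j \<le> 2 * r + 1\<close> decreases in \<open>r\<close> and equals \<open>5/6\<close> at \<open>r = 1\<close>.
\<close>

lemma nu_ge_sixth:
  assumes "1 \<le> r" "k \<le> 2 * r + 1"
  shows "1 / 6 \<le> nu k r"
  using nu_ge_harmonic[of r "2 * r + 1"] harmonic_block_le[OF assms(1)] nu_antimono[OF assms] assms
  by simp

text \<open>
  Beyond the first \<open>r\<close> terms each term is at most half of the one \<open>r\<close> places earlier, so the sum \<open>S\<close>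
  satisfies \<open>S \<le> r * nu k + S/2\<close>.
\<close>

lemma sum_nu_tail_le:
  assumes "1 \<le> r" "r \<le> k"
  shows "(\<Sum>i\<in>{k<..N}. nu i r) \<le> 2 * real r * nu k r"
proof -
  let ?S = "\<Sum>i\<in>{k<..N}. nu i r"
  have "?S \<le> (\<Sum>i\<in>{k<..k + r} \<union> {k + r<..N}. nu i r)"
    using nu_nonneg by (intro sum_mono2) auto
  also have "\<dots> = (\<Sum>i\<in>{k<..k + r}. nu i r) + (\<Sum>i\<in>{k + r<..N}. nu i r)"
    by (intro sum.union_disjoint) auto
  also have "(\<Sum>i\<in>{k<..k + r}. nu i r) \<le> (\<Sum>i\<in>{k<..k + r}. nu k r)"
    using nu_antimono[OF assms(1)] by (intro sum_mono) simp
  also have "(\<Sum>i\<in>{k + r<..N}. nu i r) \<le> (\<Sum>i\<in>{k + r<..N}. nu (i - r) r / 2)"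
  proof (rule sum_mono)
    fix i assume "i \<in> {k + r<..N}"
    then show "nu i r \<le> nu (i - r) r / 2" using nu_halves[OF assms(1), of i] assms by simp
  qed
  also have "\<dots> = (\<Sum>i\<in>{k<..N - r}. nu i r / 2)"
    by (rule sum.reindex_bij_witness[where i = "\<lambda>i. i + r" and j = "\<lambda>i. i - r"]) auto
  also have "\<dots> \<le> (\<Sum>i\<in>{k<..N}. nu i r / 2)"
    using nu_nonneg by (intro sum_mono2) auto
  finally show ?thesis by (simp add: sum_divide_distrib[symmetric])
qed

lemma rough_eq_0: "1 \<le> k \<Longrightarrow> k \<le> r \<Longrightarrow> rough r k = 0"
  using rough_rec[of k r] by simp

lemma rough_eq_inverse:
  assumes "r < k" "k \<le> 2 * r + 1"
  shows "rough r k = 1 / real k"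
proof -
  have "(\<Sum>i<k - r. rough r i) = (\<Sum>i\<in>{0}. rough r i)"
    using assms by (intro sum.mono_neutral_right) (auto intro!: rough_eq_0)
  then show ?thesis using rough_rec[of k r] assms by (simp add: field_simps)
qed

lemma rough_step:
  assumes "1 \<le> r" "r \<le> k"
  shows "real (k + 1) * (rough r (k + 1) - rough r k) = - (rough r k - rough r (k - r))"
proof -
  have "k + 1 - r = Suc (k - r)" using assms by simp
  then show ?thesis
    using rough_rec[of k r] rough_rec[of "k + 1" r] assms by (simp add: algebra_simps)
qed

text \<open>
  The heart of the proof. By \<open>rough_step\<close> the increments \<open>b k = rough k - rough (k - 1)\<close> satisfy
  \<open>k * b k = - (b (k - r) + \<dots> + b (k - 1))\<close>, which up to the sign is the recurrence of \<open>nu\<close>. Hence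
  a bound \<open>\<bar>b k\<bar> \<le> M * nu k\<close> on one window of length \<open>r\<close> propagates to all later \<open>k\<close>. On the window
  \<open>r + 2 \<le> k \<le> 2 * r + 1\<close> the increments of \<open>1/k\<close> are of order \<open>1/r\<^sup>2\<close>, and \<open>nu k \<ge> 1/6\<close>. The large
  increment at \<open>k = r + 1\<close> lies before this window.
\<close>

lemma abs_rough_increment_le:
  assumes "1 \<le> r" "r + 1 \<le> k"
  shows "\<bar>rough r (k + 1) - rough r k\<bar> \<le> 6 / real r ^ 2 * nu (k + 1) r"
  using assms(2)
proof (induction k rule: less_induct)
  case (less k)
  have r: "0 < real r" using assms by simp
  show ?case
  proof (cases "k \<le> 2 * r")
    case True
    have "\<bar>rough r (k + 1) - rough r k\<bar> = 1 / (real k * real (k + 1))"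
      using True less.prems by (simp add: rough_eq_inverse field_simps)
    also have "\<dots> \<le> 1 / (real r * real r)"
      using r less.prems by (intro divide_left_mono mult_mono) auto
    also have "\<dots> \<le> 6 / real r ^ 2 * nu (k + 1) r"
      using nu_ge_sixth[OF assms(1), of "k + 1"] True r by (simp add: power2_eq_square field_simps)
    finally show ?thesis .
  next
    case False
    have "real (k + 1) * \<bar>rough r (k + 1) - rough r k\<bar> = \<bar>rough r k - rough r (k - r)\<bar>"
      using arg_cong[OF rough_step[of r k], of abs] assms(1) False by (simp add: abs_mult)
    also have "\<dots> = \<bar>\<Sum>i\<in>{k - r..<k}. rough r (Suc i) - rough r i\<bar>"
      by (subst sum_Suc_diff') auto
    also have "\<dots> \<le> (\<Sum>i\<in>{k - r..<k}. \<bar>rough r (i + 1) - rough r i\<bar>)"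
      by (simp only: Suc_eq_plus1 sum_abs)
    also have "\<dots> \<le> (\<Sum>i\<in>{k - r..<k}. 6 / real r ^ 2 * nu (i + 1) r)"
      using less.IH False by (intro sum_mono) auto
    also have "\<dots> = 6 / real r ^ 2 * (\<Sum>i\<in>{k + 1 - r..<k + 1}. nu i r)"
      unfolding sum_distrib_left using False
      by (intro sum.reindex_bij_witness[where i = "\<lambda>i. i - 1" and j = Suc]) auto
    also have "\<dots> = real (k + 1) * (6 / real r ^ 2 * nu (k + 1) r)"
      unfolding nu_rec[symmetric] by simp
    finally show ?thesis by (simp only: mult_le_cancel_left_pos of_nat_0_less_iff)
  qed
qed

lemma rough_close_later:
  assumes "1 \<le> r" "r < k" "k \<le> N"
  shows "\<bar>rough r N - rough r k\<bar> \<le> 12 / real r * nu k r"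
proof -
  have "\<bar>rough r N - rough r k\<bar> = \<bar>\<Sum>i\<in>{k..<N}. rough r (Suc i) - rough r i\<bar>"
    using assms by (subst sum_Suc_diff') auto
  also have "\<dots> \<le> (\<Sum>i\<in>{k..<N}. \<bar>rough r (i + 1) - rough r i\<bar>)"
    by (simp only: Suc_eq_plus1 sum_abs)
  also have "\<dots> \<le> (\<Sum>i\<in>{k..<N}. 6 / real r ^ 2 * nu (i + 1) r)"
    using assms by (intro sum_mono abs_rough_increment_le) auto
  also have "\<dots> = 6 / real r ^ 2 * (\<Sum>i\<in>{k<..N}. nu i r)"
    unfolding sum_distrib_left
    by (intro sum.reindex_bij_witness[where i = "\<lambda>i. i - 1" and j = Suc]) auto
  also have "\<dots> \<le> 6 / real r ^ 2 * (2 * real r * nu k r)"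
    using assms by (intro mult_left_mono sum_nu_tail_le) auto
  also have "\<dots> = 12 / real r * nu k r"
    by (simp add: power2_eq_square)
  finally show ?thesis .
qed

text \<open>
  Both the total mass of the joint law and the deviation from the Poisson law depend on the vector,
  apart from Cauchy's weight, only through its weight.
\<close>

lemma sum_by_weight:
  "(\<Sum>v | v \<in> nat_vectors r \<and> weight r v \<le> n. cauchy_weight r v * f (weight r v)) =
   (\<Sum>m\<le>n. nu m r * f m)"
proof -
  let ?S = "{v \<in> nat_vectors r. weight r v \<le> n}"
  have "(\<Sum>v\<in>?S. cauchy_weight r v * f (weight r v)) =
      (\<Sum>m\<le>n. \<Sum>v\<in>{v \<in> ?S. weight r v = m}. cauchy_weight r v * f (weight r v))"
    by (intro sum.group[symmetric] finite_nat_vectors_weight_le) auto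
  also have "\<dots> = (\<Sum>m\<le>n. \<Sum>v\<in>vectors_of_weight r m. cauchy_weight r v * f m)"
    by (intro sum.cong) (auto simp: vectors_of_weight_def)
  finally show ?thesis by (simp add: nu_eq_sum_cauchy_weight sum_distrib_right)
qed

lemma nu_rough_convolution: "(\<Sum>m\<le>n. nu m r * rough r (n - m)) = 1"
proof -
  have "cycle_vector n r \<sigma> \<in> nat_vectors r" for \<sigma>
    by (auto simp: cycle_vector_def nat_vectors_def PiE_dflt_def)
  then have "1 = (\<Sum>v | v \<in> nat_vectors r \<and> weight r v \<le> n. cauchy_weight r v * rough r (n - weight r v))"
    using card_cycle_vector_in[of "nat_vectors r" r n] by (simp add: card_permutations)
  then show ?thesis unfolding sum_by_weight[where f = "\<lambda>m. rough r (n - m)"] ..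
qed

text \<open>
  By \<open>nu_rough_convolution\<close> the generating series of \<open>rough\<close> is \<open>1/(1 - x)\<close> divided by that of
  \<open>nu\<close>. So the series of increments of \<open>rough\<close> and the series \<open>nu\<close> have Cauchy product 1; both
  converge absolutely, and at \<open>x = 1\<close> the limit of \<open>rough\<close> times \<open>exp (harm r)\<close> is 1.
\<close>

lemma rough_tendsto:
  assumes "1 \<le> r"
  shows "rough r \<longlonglongrightarrow> exp (- harm r)"
proof -
  \<comment> \<open>the value at 0 makes the partial sums of \<open>b\<close> equal to \<open>rough\<close>\<close>
  define b where "b k = (if k = 0 then 1 else rough r k - rough r (k - 1))" for k
  have partial: "(\<Sum>k\<le>N. b k) = rough r N" for N
    by (induction N) (simp_all add: b_def)
  have summable_nu: "summable (\<lambda>k. nu k r)"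
    using sums_nu by (rule sums_summable)
  have summable_b: "summable (\<lambda>k. norm (b k))"
  proof (rule summable_comparison_test_ev)
    show "\<forall>\<^sub>F k in sequentially. norm (norm (b k)) \<le> 6 / real r ^ 2 * nu k r"
      unfolding eventually_sequentially
    proof (intro exI[of _ "r + 2"] allI impI)
      fix k assume "r + 2 \<le> k"
      then show "norm (norm (b k)) \<le> 6 / real r ^ 2 * nu k r"
        using abs_rough_increment_le[OF assms, of "k - 1"] by (simp add: b_def)
    qed
    show "summable (\<lambda>k. 6 / real r ^ 2 * nu k r)"
      using summable_nu by (rule summable_mult)
  qed
  have "(\<Sum>i\<le>k. nu i r * b (k - i)) = (if k = 0 then 1 else 0)" for k
  proof (cases k)
    case 0
    then show ?thesis by (simp add: b_def nu_eq_1)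
  next
    case (Suc l)
    have "(\<Sum>i\<le>Suc l. nu i r * b (Suc l - i)) =
        (\<Sum>i\<le>Suc l. nu i r * rough r (Suc l - i)) - (\<Sum>i\<le>l. nu i r * rough r (l - i))"
      by (simp add: b_def Suc_diff_le right_diff_distrib sum_subtractf)
    then show ?thesis using Suc nu_rough_convolution by simp
  qed
  then have "(\<lambda>k. if k = 0 then 1 else 0) sums ((\<Sum>k. nu k r) * (\<Sum>k. b k))"
    using Cauchy_product_sums[of "\<lambda>k. nu k r" b] summable_nu summable_b nu_nonneg by simp
  moreover have "(\<lambda>k::nat. if k = 0 then 1 else 0 :: real) sums 1"
    using sums_single[of 0 "\<lambda>_. 1::real"] by simp
  ultimately have "(\<Sum>k. nu k r) * (\<Sum>k. b k) = 1" by (rule sums_unique2)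
  then have "(\<Sum>k. b k) = exp (- harm r)"
    unfolding sums_unique[OF sums_nu[of r], symmetric] by (simp add: exp_minus field_simps)
  moreover have "b sums (\<Sum>k. b k)"
    using summable_norm_cancel[OF summable_b] by (rule summable_sums)
  ultimately show ?thesis by (simp add: sums_def_le partial)
qed

lemma rough_close_limit:
  assumes "1 \<le> r" "r < k"
  shows "\<bar>rough r k - exp (- harm r)\<bar> \<le> 12 / real r * nu k r"
proof (rule tendsto_upperbound)
  show "(\<lambda>N. \<bar>rough r k - rough r N\<bar>) \<longlonglongrightarrow> \<bar>rough r k - exp (- harm r)\<bar>"
    by (intro tendsto_intros rough_tendsto assms)
  show "\<forall>\<^sub>F N in sequentially. \<bar>rough r k - rough r N\<bar> \<le> 12 / real r * nu k r"
    unfolding eventually_sequentially using rough_close_later[OF assms] by (metis abs_minus_commute)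
qed simp

lemma exp_minus_harm_le: "1 \<le> r \<Longrightarrow> exp (- harm r) \<le> 1 / real r"
proof -
  assume "1 \<le> r"
  have "exp (ln (real r + 1)) \<le> exp (harm r)"
    using ln_le_harm[of r] by (simp only: exp_le_cancel_iff)
  then have "real r \<le> exp (harm r)" by simp
  then show ?thesis using \<open>1 \<le> r\<close> by (simp add: exp_minus field_simps)
qed

section \<open>The total variation distance\<close>

text \<open>
  The joint law and the Poisson law have the common factor \<open>cauchy_weight\<close>, so a vector of weight
  \<open>m \<le> n\<close> contributes in proportion to \<open>rough r (n - m) - exp (- harm r)\<close>; heavier vectors
  carry Poisson mass only.
\<close>

lemma deviation_le:
  assumes V: "V \<subseteq> nat_vectors r"
  shows "\<bar>real (card {\<sigma>. \<sigma> permutes {1..n} \<and> cycle_vector n r \<sigma> \<in> V}) / fact n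
        - measure_pmf.prob (poisson_vector r) V\<bar>
    \<le> (\<Sum>m\<le>n. nu m r * \<bar>rough r (n - m) - exp (- harm r)\<bar>)
       + exp (- harm r) * (\<Sum>\<^sub>\<infinity>m\<in>{n<..}. nu m r)"
proof -
  let ?E = "exp (- harm r) :: real" and ?P = "measure_pmf.prob (poisson_vector r)"
  let ?V = "{v. v \<in> V \<and> weight r v \<le> n}" and ?W = "{v \<in> nat_vectors r. weight r v \<le> n}"
  let ?D = "\<Sum>v\<in>?V. cauchy_weight r v * (rough r (n - weight r v) - ?E)"
  have fin: "finite ?V"
    using finite_nat_vectors_weight_le[of r n] by (rule rev_finite_subset) (use V in auto)
  have w: "cauchy_weight r v \<ge> 0" for v
    unfolding cauchy_weight_def by (intro prod_nonneg) auto
  have "?P V = ?P (?V \<union> {v \<in> V. n < weight r v})"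
    by (rule arg_cong[of _ _ ?P]) auto
  also have "\<dots> = ?P ?V + ?P {v \<in> V. n < weight r v}"
    by (intro measure_pmf.finite_measure_Union) auto
  also have "?P ?V = (\<Sum>v\<in>?V. ?E * cauchy_weight r v)"
    unfolding measure_measure_pmf_finite[OF fin]
    using V by (intro sum.cong refl pmf_poisson_vector) auto
  finally have "real (card {\<sigma>. \<sigma> permutes {1..n} \<and> cycle_vector n r \<sigma> \<in> V}) / fact n - ?P V
      = ?D - ?P {v \<in> V. n < weight r v}"
    unfolding card_cycle_vector_in[OF V]
    by (simp add: sum_subtractf right_diff_distrib mult.commute)
  moreover have "\<bar>?D\<bar> \<le> (\<Sum>m\<le>n. nu m r * \<bar>rough r (n - m) - ?E\<bar>)"
  proof -
    have "\<bar>?D\<bar> \<le> (\<Sum>v\<in>?V. \<bar>cauchy_weight r v * (rough r (n - weight r v) - ?E)\<bar>)"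
      by (rule sum_abs)
    also have "\<dots> = (\<Sum>v\<in>?V. cauchy_weight r v * \<bar>rough r (n - weight r v) - ?E\<bar>)"
      using w by (simp add: abs_mult)
    also have "\<dots> \<le> (\<Sum>v\<in>?W. cauchy_weight r v * \<bar>rough r (n - weight r v) - ?E\<bar>)"
      using V w finite_nat_vectors_weight_le by (intro sum_mono2) auto
    also have "\<dots> = (\<Sum>m\<le>n. nu m r * \<bar>rough r (n - m) - ?E\<bar>)"
      by (rule sum_by_weight[where f = "\<lambda>m. \<bar>rough r (n - m) - ?E\<bar>"])
    finally show ?thesis .
  qed
  moreover have "?P {v \<in> V. n < weight r v} \<le> ?E * (\<Sum>\<^sub>\<infinity>m\<in>{n<..}. nu m r)"
    unfolding infsum_nu by (intro measure_pmf.finite_measure_mono) auto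
  moreover have "0 \<le> ?P {v \<in> V. n < weight r v}" by simp
  ultimately show ?thesis by linarith
qed

lemma infsum_nu_split:
  assumes "k \<le> n"
  shows "(\<Sum>\<^sub>\<infinity>m\<in>{k..}. nu m r) = (\<Sum>m\<in>{k..n}. nu m r) + (\<Sum>\<^sub>\<infinity>m\<in>{n<..}. nu m r)"
proof -
  have "{k..} = {k..n} \<union> {n<..}" "{k..n} \<inter> {n<..} = {}" using assms by auto
  then show ?thesis
    using infsum_Un_disjoint[OF summable_on_nu[of r "{k..n}"] summable_on_nu[of r "{n<..}"]] by simp
qed

theorem corollary4p3:
  shows "\<exists>C>0::real. \<forall>n r :: nat. 5 \<le> r \<and> r < n \<longrightarrow>
    d_TV n r \<le> C * (1 / real r * (\<Sum>m = 0..n - r - 1. nu m r * nu (n - m) r)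
                    + 1 / real r * (\<Sum>\<^sub>\<infinity>m\<in>{n - r..}. nu m r)
                    + nu n r)"
proof (intro exI[of _ 12] conjI allI impI)
  fix n r :: nat
  assume "5 \<le> r \<and> r < n"
  then have r: "1 \<le> r" "r < n" by auto
  let ?E = "exp (- harm r) :: real"
  let ?A = "\<Sum>m = 0..n - r - 1. nu m r * nu (n - m) r"
  let ?B = "\<Sum>\<^sub>\<infinity>m\<in>{n - r..}. nu m r" and ?T = "\<Sum>\<^sub>\<infinity>m\<in>{n<..}. nu m r"
  let ?f = "\<lambda>m. nu m r * \<bar>rough r (n - m) - ?E\<bar>"
  have E: "0 \<le> ?E" "?E \<le> 1 / real r" "?E \<le> 1"
    using exp_minus_harm_le[OF r(1)] harm_nonneg[of r] by auto
  \<comment> \<open>more than \<open>r\<close> symbols left over: \<open>rough\<close> is close to its limit\<close>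
  have low: "(\<Sum>m = 0..n - r - 1. ?f m) \<le> 12 / real r * ?A"
    unfolding sum_distrib_left
  proof (rule sum_mono)
    fix m assume "m \<in> {0..n - r - 1}"
    then have "r < n - m" using r by auto
    then have "?f m \<le> nu m r * (12 / real r * nu (n - m) r)"
      by (intro mult_left_mono rough_close_limit r nu_nonneg)
    then show "?f m \<le> 12 / real r * (nu m r * nu (n - m) r)" by (simp add: mult_ac)
  qed
  \<comment> \<open>between 1 and \<open>r\<close> symbols left over: \<open>rough\<close> vanishes and only Poisson mass remains\<close>
  have mid: "(\<Sum>m = n - r..<n. ?f m) = ?E * (\<Sum>m = n - r..<n. nu m r)"
    unfolding sum_distrib_left
    using E by (intro sum.cong refl) (auto simp: rough_eq_0)
  \<comment> \<open>nothing left over: \<open>rough\<close> is 1\<close>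
  have top: "?f n \<le> nu n r"
    using E nu_nonneg[of n r] by (intro mult_left_le) auto
  have "{..n} = {0..n - r - 1} \<union> ({n - r..<n} \<union> {n})" using r by auto
  then have "(\<Sum>m\<le>n. ?f m) = (\<Sum>m = 0..n - r - 1. ?f m) + (\<Sum>m\<in>{n - r..<n} \<union> {n}. ?f m)"
    using r by (simp only:) (rule sum.union_disjoint, auto)
  also have "(\<Sum>m\<in>{n - r..<n} \<union> {n}. ?f m) = (\<Sum>m = n - r..<n. ?f m) + ?f n"
    by (subst sum.union_disjoint) auto
  finally have split: "(\<Sum>m\<le>n. ?f m) = (\<Sum>m = 0..n - r - 1. ?f m) + ((\<Sum>m = n - r..<n. ?f m) + ?f n)" .
  have "{n - r..n} = insert n {n - r..<n}" by auto
  then have "(\<Sum>m = n - r..<n. nu m r) + ?T \<le> ?B"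
    using infsum_nu_split[of "n - r" n r] nu_nonneg[of n r] by simp
  moreover have "0 \<le> ?B" by (intro infsum_nonneg nu_nonneg)
  ultimately have tail: "?E * ((\<Sum>m = n - r..<n. nu m r) + ?T) \<le> 1 / real r * ?B"
    using E by (intro order.trans[OF mult_left_mono mult_right_mono]) auto
  have "(\<Sum>m\<le>n. ?f m) + ?E * ?T \<le> 12 / real r * ?A + 1 / real r * ?B + nu n r"
    using low top tail unfolding split mid by (simp only: distrib_left)
  also have "\<dots> \<le> 12 * (1 / real r * ?A + 1 / real r * ?B + nu n r)"
  proof -
    have "0 \<le> 1 / real r * ?B" using \<open>0 \<le> ?B\<close> by simp
    moreover have "12 / real r * a + x + y \<le> 12 * (1 / real r * a + x + y)"
      if "0 \<le> x" "0 \<le> y" for a x y :: real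
      using that by (simp add: distrib_left)
    ultimately show ?thesis using nu_nonneg[of n r] by blast
  qed
  finally show "d_TV n r \<le> 12 * (1 / real r * ?A + 1 / real r * ?B + nu n r)"
    unfolding d_TV_def
    by (intro cSUP_least order.trans[OF deviation_le]) auto
qed simp

end
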